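(* Let $m\ge0$ be an integer and for $0\le s\le m$ let $$P_{m,s}(y)=\frac{\prod_{j=0}^{s}(1-y^{m+1-j})}{(1-y)^{3s}}\sum_{k=0}^{s}\frac{(-1)^{s-k}}{1-y^{m+1-k}}\left[\binom{2m}{k}-\binom{2m}{k-2}\right]\sum_{i=0}^{s-k}\frac{m-k+1}{m-s+1}\binom{m-s+i}{i}\binom{m-k-i}{s-k-i}y^{s-k-i}.$$ Then each $P_{m,s}(y)\in\mathbb{Z}[y]$, and as rational functions in indeterminates $x,y$, $$\sum_{k=0}^{m}(-1)^k\left[\binom{2m}{k}-\binom{2m}{k-2}\right]\frac{(1-x^{m+1-k})(1-x^{m+1-k}y^{m+1-k})x^k}{1-y^{m+1-k}}=\sum_{k=0}^{m}(-1)^kP_{m,k}(y)\frac{(1-x)^{m+1-k}(1-xy)^{m+1-k}(1-y)^{3k}x^k}{\prod_{i=0}^{k}(1-y^{m+1-i})}.$$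
   Context: Binomial coefficients $\binom{a}{b}$ with integers $a,b$ are taken to be $0$ when $b<0$ or when $0\le a<b$. *)

theory Defs
  imports "HOL-Computational_Algebra.Polynomial" "HOL-Computational_Algebra.Fraction_Field"
begin

text \<open>Rational functions in two indeterminates x, y over the rationals are modelled as the
fraction field of (Q[y])[x]: the outer polynomial variable is x, coefficients are polynomials in y.\<close>

type_synonym ratfun2 = "rat poly poly fract"

definition Xv :: ratfun2 where "Xv = Fract [:0, 1:] 1"
definition Yv :: ratfun2 where "Yv = Fract [:[:0, 1:]:] 1"

definition ypoly :: "int poly \<Rightarrow> ratfun2" where
  "ypoly p = Fract [:map_poly of_int p:] 1"

definition cbin :: "nat \<Rightarrow> int \<Rightarrow> int" where
  "cbin a b = (if b < 0 then 0 else int (a choose nat b))"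

definition Pms :: "nat \<Rightarrow> nat \<Rightarrow> ratfun2" where
  "Pms m s =
     (\<Prod>j=0..s. 1 - Yv ^ (m + 1 - j)) / (1 - Yv) ^ (3 * s) *
     (\<Sum>k=0..s. (-1) ^ (s - k) / (1 - Yv ^ (m + 1 - k)) *
        of_int (cbin (2 * m) (int k) - cbin (2 * m) (int k - 2)) *
        (\<Sum>i=0..s-k. of_nat (m - k + 1) / of_nat (m - s + 1) *
            of_nat ((m - s + i) choose i) * of_nat ((m - k - i) choose (s - k - i)) *
            Yv ^ (s - k - i)))"

end

theory Submission
  imports Defs "HOL-Computational_Algebra.Formal_Power_Series"
begin

text \<open>
  Put u = (1 - x)(1 - x y). For n > 0 the product (1 - x^n)(1 - x^n y^n) is a combination of the
  x^j u^(n-j) with j < n, and the coefficients are exactly the inner sums of the polynomials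
  \<^term>\<open>Pms m s\<close>; substituting this and collecting powers of u gives the identity.

  For integrality, specialise x = y^N. By the antisymmetry of the coefficients of
  (1 - z)^(2m) (1 - z^2), the left-hand side of the identity becomes, up to a power of y, the sum of
  y^(-(m+1)l) (1 - y^l)^(2m) (1 - y^(2l)) over 1 \<le> l \<le> N, which vanishes to order 2m+1 at y = 1.
  On the other side u = (1 - y)^2 E with E = N(N+1) at y = 1. As this holds for all N, the
  coefficient of each power of u must vanish separately to the appropriate order, which cancels
  the denominator (1 - y)^(3s).
\<close>

unbundle fps_syntax

section \<open>Powers of the geometric series 1/(1 - a X)\<close>

definition geo :: "'a::comm_ring_1 \<Rightarrow> 'a fps" where
  "geo a = Abs_fps (\<lambda>n. a ^ n)"

lemma linear_mult_nth:
  fixes a :: "'a::comm_ring_1"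
  shows "((1 - fps_const a * fps_X) * f) $ n = f $ n - (if n = 0 then 0 else a * f $ (n - 1))"
  by (simp add: left_diff_distrib mult.assoc)

lemma geo_inverse: "(1 - fps_const a * fps_X) * geo a = 1"
  by (rule fps_ext, unfold linear_mult_nth)
     (auto simp: geo_def power_eq_if)

text \<open>Multiplication by 1 - a X takes weighted differences of consecutive coefficients; by
  Pascal's rule it turns the claimed series for r + 1 into the one for r.\<close>

lemma geo_power_nth: "(geo a ^ Suc r) $ n = of_nat ((n + r) choose r) * a ^ n"
proof -
  define B where "B r = Abs_fps (\<lambda>n. of_nat ((n + r) choose r) * a ^ n)" for r
  have step: "(1 - fps_const a * fps_X) * B (Suc r) = B r" for r
  proof (rule fps_ext)
    fix n
    show "((1 - fps_const a * fps_X) * B (Suc r)) $ n = B r $ n"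
      unfolding linear_mult_nth by (cases n) (auto simp: B_def algebra_simps binomial_eq_0)
  qed
  have "geo a ^ Suc r = B r"
  proof (induction r)
    case 0
    show ?case by (simp add: B_def geo_def)
  next
    case (Suc r)
    have "geo a ^ Suc (Suc r) = geo a * B r" using Suc by simp
    also have "\<dots> = ((1 - fps_const a * fps_X) * geo a) * B (Suc r)"
      unfolding step[of r, symmetric] by (simp only: ac_simps)
    finally show ?case by (simp add: geo_inverse)
  qed
  then show ?thesis by (simp add: B_def)
qed

text \<open>With p and q the two denominators, 1 - (1 - p)(1 - q) = p + q - p q is the left factor,
  and dividing by p q leaves 1/q + 1/p - 1.\<close>

lemma geo_mult_geo:
  "(1 - fps_const (a * b) * fps_X\<^sup>2) * (geo a * geo b) = geo a + geo b - 1"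
proof -
  define p q where "p = 1 - fps_const a * fps_X" and "q = 1 - fps_const b * fps_X"
  have "1 - fps_const (a * b) * fps_X\<^sup>2 = p + q - p * q"
    by (simp add: p_def q_def algebra_simps power2_eq_square flip: fps_const_mult)
  then have "(1 - fps_const (a * b) * fps_X\<^sup>2) * (geo a * geo b)
      = (p * geo a) * geo b + (q * geo b) * geo a - (p * geo a) * (q * geo b)"
    by (simp only:) (simp add: algebra_simps)
  then show ?thesis
    unfolding p_def q_def geo_inverse by simp
qed

section \<open>Expansion of (1 - x^n)(1 - x^n y^n) in powers of u\<close>

lemma power_sum_expansion:
  fixes x y :: "'a::comm_ring_1"
  assumes "0 < n"
  shows "1 + (x\<^sup>2 * y) ^ n = (\<Sum>r\<le>n. ((1 - x) * (1 - x * y)) ^ r *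
    ((1 - fps_const (x\<^sup>2 * y) * fps_X\<^sup>2) * (geo x * geo (x * y)) ^ Suc r) $ (n - r))"
proof -
  \<comment> \<open>The geometric series in g Z telescopes because (1 - x t)(1 - x y t) - u t = (1 - t)(1 - x^2 y t).\<close>
  define u where "u = (1 - x) * (1 - x * y)"
  define g h Z where "g = geo x * geo (x * y)"
    and "h = 1 - fps_const (x\<^sup>2 * y) * fps_X\<^sup>2"
    and "Z = fps_const u * (fps_X :: 'a fps)"
  define p q where "p = 1 - fps_const x * fps_X" and "q = 1 - fps_const (x * y) * fps_X"
  define k l where "k = 1 - fps_const 1 * (fps_X :: 'a fps)" and "l = 1 - fps_const (x\<^sup>2 * y) * fps_X"
  have pq: "p * q - Z = k * l"
    by (rule fps_ext)
       (simp add: p_def q_def Z_def k_def l_def u_def algebra_simps power2_eq_square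
         flip: fps_const_mult fps_const_add fps_const_sub)
  have pqg: "p * q * g = 1"
  proof -
    have "p * q * g = (p * geo x) * (q * geo (x * y))" by (simp add: g_def ac_simps)
    then show ?thesis by (simp add: p_def q_def geo_inverse)
  qed
  have kl: "(geo 1 * geo (x\<^sup>2 * y)) * (k * l) = 1"
  proof -
    have "(geo 1 * geo (x\<^sup>2 * y)) * (k * l) = (k * geo 1) * (l * geo (x\<^sup>2 * y))" by (simp add: ac_simps)
    then show ?thesis unfolding k_def l_def geo_inverse by simp
  qed
  define S where "S = (\<Sum>r\<le>n. h * g ^ Suc r * Z ^ r)"
  have "k * l * g = 1 - g * Z"
    using pqg by (simp add: pq[symmetric] algebra_simps)
  have "S = h * g * (\<Sum>r\<le>n. (g * Z) ^ r)"
    by (simp add: S_def sum_distrib_left power_mult_distrib ac_simps)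
  then have "k * l * S = h * ((k * l * g) * (\<Sum>r\<le>n. (g * Z) ^ r))"
    by (simp add: ac_simps)
  also have "\<dots> = h * (1 - (g * Z) ^ Suc n)"
    by (simp only: \<open>k * l * g = _\<close> sum_gp_basic)
  finally have "S = (geo 1 * geo (x\<^sup>2 * y)) * (h * (1 - (g * Z) ^ Suc n))"
    using kl by (metis mult.assoc mult.left_neutral)
  also have "\<dots> = (h * (geo 1 * geo (x\<^sup>2 * y))) * (1 - (g * Z) ^ Suc n)"
    by (simp only: ac_simps)
  also have "h * (geo 1 * geo (x\<^sup>2 * y)) = geo 1 + geo (x\<^sup>2 * y) - 1"
    using geo_mult_geo[of 1 "x\<^sup>2 * y"] by (simp add: h_def)
  finally have S: "S = (geo 1 + geo (x\<^sup>2 * y) - 1)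
      - ((geo 1 + geo (x\<^sup>2 * y) - 1) * g ^ Suc n * fps_const (u ^ Suc n)) * fps_X ^ Suc n"
    by (simp add: Z_def algebra_simps power_mult_distrib fps_const_power)
  \<comment> \<open>The tail cut off at r = n is divisible by X^(n+1) and does not reach this
    coefficient; neither does the constant -1, as n > 0.\<close>
  have "S $ n = 1 + (x\<^sup>2 * y) ^ n"
    unfolding S fps_sub_nth fps_X_power_mult_right_nth
    using assms by (simp add: geo_def)
  moreover have "S $ n = (\<Sum>r\<le>n. u ^ r * (h * g ^ Suc r) $ (n - r))"
    unfolding S_def fps_sum_nth
  proof (rule sum.cong)
    fix r assume "r \<in> {..n}"
    have "h * g ^ Suc r * Z ^ r = fps_const (u ^ r) * ((h * g ^ Suc r) * fps_X ^ r)"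
      by (simp add: Z_def power_mult_distrib fps_const_power ac_simps)
    then show "(h * g ^ Suc r * Z ^ r) $ n = u ^ r * (h * g ^ Suc r) $ (n - r)"
      using \<open>r \<in> {..n}\<close> by (simp only: fps_mult_left_const_nth fps_X_power_mult_right_nth) auto
  qed simp
  ultimately show ?thesis by (simp add: u_def g_def h_def)
qed

text \<open>
  With r = p + 1 - j and l = j - i, the i-th summand of the inner sum in \<^term>\<open>Pms m s\<close> is
  (r+i+l)/r * C(r-1+i,i) * C(r-1+l,l). Writing (r+i+l)/r = (r+i)/r + l/r makes it the integer below.
\<close>

definition lcoef :: "nat \<Rightarrow> nat \<Rightarrow> 'a::comm_ring_1 \<Rightarrow> 'a" where
  "lcoef p j y = (\<Sum>i\<le>j. of_nat ((Suc (p - j) + i choose i) * (p - i choose (j - i))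
      + (p - j + i choose i) * (p - i choose Suc (p - j))) * y ^ (j - i))"

text \<open>With c = 1 - x X and d = 1 - x y X, the numerator is d + x y X c, so each of its two
  terms cancels one factor of the denominator. What remains are two Cauchy products of binomial
  series, one for each part of the integer weight in \<open>lcoef\<close>.\<close>

lemma geo_coeff:
  fixes x y :: "'a::comm_ring_1"
  assumes "j \<le> p"
  shows "((1 - fps_const (x\<^sup>2 * y) * fps_X\<^sup>2) * (geo x * geo (x * y)) ^ Suc (Suc (p - j))) $ j
    = x ^ j * lcoef p j y"
proof -
  define q where "q = p - j"
  define a b where "a = geo x" and "b = geo (x * y)"
  define c where "c = 1 - fps_const x * fps_X"
  define d where "d = 1 - fps_const (x * y) * fps_X"
  have ca: "c * a = 1" and db: "d * b = 1"
    by (simp_all add: a_def b_def c_def d_def geo_inverse)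
  have "1 - fps_const (x\<^sup>2 * y) * fps_X\<^sup>2 = d + fps_const (x * y) * fps_X * c"
    by (simp add: c_def d_def algebra_simps power2_eq_square flip: fps_const_mult)
  then have "(1 - fps_const (x\<^sup>2 * y) * fps_X\<^sup>2) * (a * b) ^ Suc (Suc q)
    = a ^ Suc (Suc q) * b ^ Suc q * (d * b)
      + fps_const (x * y) * fps_X * (a ^ Suc q * b ^ Suc (Suc q)) * (c * a)"
    by (simp only: distrib_right power_mult_distrib power_Suc) (simp only: ac_simps)
  also have "\<dots> = a ^ Suc (Suc q) * b ^ Suc q
      + a ^ Suc q * (fps_const (x * y) * fps_X * b ^ Suc (Suc q))"
    unfolding ca db by (simp only: mult_1_right mult.left_commute)
  finally have *: "(1 - fps_const (x\<^sup>2 * y) * fps_X\<^sup>2) * (a * b) ^ Suc (Suc q)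
    = a ^ Suc (Suc q) * b ^ Suc q + a ^ Suc q * (fps_const (x * y) * fps_X * b ^ Suc (Suc q))" .
  define e where "e = fps_const (x * y) * fps_X * b ^ Suc (Suc q)"
  \<comment> \<open>The factor X shifts the index by one: \<open>geo_power_nth\<close> at l - 1
    gives this binomial coefficient, which also has the right value 0 at l = 0.\<close>
  have e_nth: "e $ l
      = of_nat (l + q choose Suc q) * (x * y) ^ l" for l
  proof (cases l)
    case (Suc k)
    then show ?thesis
      by (simp only: e_def b_def mult.assoc fps_mult_left_const_nth fps_X_mult_nth geo_power_nth)
         (simp add: ac_simps)
  qed (simp add: e_def mult.assoc binomial_eq_0)
  have "(a ^ Suc (Suc q) * b ^ Suc q + a ^ Suc q * e) $ j
    = (\<Sum>i=0..j. of_nat (i + Suc q choose Suc q) * x ^ i * (of_nat (j - i + q choose q) * (x * y) ^ (j - i))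
       + of_nat (i + q choose q) * x ^ i * (of_nat (j - i + q choose Suc q) * (x * y) ^ (j - i)))"
    by (simp only: fps_add_nth fps_mult_nth e_nth a_def b_def geo_power_nth sum.distrib)
  also have "\<dots> = (\<Sum>i\<le>j. x ^ j * (of_nat ((Suc q + i choose i) * (p - i choose (j - i))
      + (q + i choose i) * (p - i choose Suc q)) * y ^ (j - i)))"
  proof (rule sum.cong)
    fix i assume "i \<in> {..j}"
    then have i: "i \<le> j" by simp
    have 0: "j - i + q = p - i" using i assms by (simp add: q_def)
    have 1: "(i + Suc q choose Suc q) = (Suc q + i choose i)"
      using binomial_symmetric[of i "i + Suc q"] by (simp add: add.commute)
    have 2: "(i + q choose q) = (q + i choose i)"
      using binomial_symmetric[of i "i + q"] by (simp add: add.commute)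
    have 3: "(p - i choose q) = (p - i choose (j - i))"
      using binomial_symmetric[of q "j - i + q"] unfolding 0[symmetric] by simp
    have 4: "x ^ j = x ^ i * x ^ (j - i)" using i by (simp flip: power_add)
    have regroup: "A * X * (B * (X' * Y)) + C * X * (D * (X' * Y)) = X * X' * ((A * B + C * D) * Y)"
      for A B C D X X' Y :: 'a by (simp add: algebra_simps)
    show "of_nat (i + Suc q choose Suc q) * x ^ i * (of_nat (j - i + q choose q) * (x * y) ^ (j - i))
       + of_nat (i + q choose q) * x ^ i * (of_nat (j - i + q choose Suc q) * (x * y) ^ (j - i))
       = x ^ j * (of_nat ((Suc q + i choose i) * (p - i choose (j - i))
      + (q + i choose i) * (p - i choose Suc q)) * y ^ (j - i))"
      unfolding 0 1 2 3 4 power_mult_distrib of_nat_add of_nat_mult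
      by (rule regroup)
  qed (simp add: atLeast0AtMost)
  also have "\<dots> = x ^ j * lcoef p j y"
    by (simp add: lcoef_def q_def sum_distrib_left)
  finally show ?thesis
    unfolding e_def *[symmetric] unfolding a_def b_def q_def .
qed

text \<open>With n = p + 1 the product is 1 + (x^2 y)^n - x^n - (x y)^n. In
  \<open>power_sum_expansion\<close> the summand r = 0 is exactly x^n + (x y)^n, so moving it to the
  left leaves only positive powers of u.\<close>

lemma lcoef_expansion:
  fixes x y :: "'a::comm_ring_1"
  shows "(1 - x ^ Suc p) * (1 - x ^ Suc p * y ^ Suc p)
    = (\<Sum>j\<le>p. lcoef p j y * x ^ j * ((1 - x) * (1 - x * y)) ^ (Suc p - j))"
proof -
  define u h where "u = (1 - x) * (1 - x * y)"
    and "h = 1 - fps_const (x\<^sup>2 * y) * fps_X\<^sup>2"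
  define g where "g = geo x * geo (x * y)"
  have "h * g = geo x + geo (x * y) - 1"
    using geo_mult_geo[of x "x * y"] by (simp add: h_def g_def power2_eq_square mult.assoc)
  then have hg: "(h * g) $ Suc p = x ^ Suc p + (x * y) ^ Suc p"
    by (simp only: fps_add_nth fps_sub_nth) (simp add: geo_def)
  have "1 + (x\<^sup>2 * y) ^ Suc p = (\<Sum>r\<le>Suc p. u ^ r * (h * g ^ Suc r) $ (Suc p - r))"
    using power_sum_expansion[of "Suc p" x y] by (simp add: u_def h_def g_def)
  also have "\<dots> = (h * g) $ Suc p + (\<Sum>r\<le>p. u ^ Suc r * (h * g ^ Suc (Suc r)) $ (p - r))"
    by (subst sum.atMost_Suc_shift) simp
  also have "(\<Sum>r\<le>p. u ^ Suc r * (h * g ^ Suc (Suc r)) $ (p - r))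
      = (\<Sum>j\<le>p. u ^ Suc (p - j) * (h * g ^ Suc (Suc (p - j))) $ j)"
    by (rule sum.reindex_bij_witness[of _ "\<lambda>j. p - j" "\<lambda>j. p - j"]) auto
  also have "\<dots> = (\<Sum>j\<le>p. lcoef p j y * x ^ j * u ^ (Suc p - j))"
    by (rule sum.cong) (auto simp: h_def g_def geo_coeff Suc_diff_le simp del: power_Suc)
  finally have "1 + (x\<^sup>2 * y) ^ Suc p - x ^ Suc p - (x * y) ^ Suc p
      = (\<Sum>j\<le>p. lcoef p j y * x ^ j * u ^ (Suc p - j))"
    by (simp only: hg) simp
  then show ?thesis
    by (simp only: u_def power_mult_distrib flip: power_mult)
       (simp add: algebra_simps power_mult power2_eq_square power_mult_distrib)
qed

section \<open>The left-hand side at x = y^N, and collecting powers of u\<close>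

text \<open>The right-hand side has degree at most 2m+2 and coefficients (-1)^k \<open>b k\<close>
  with \<open>b\<close> antisymmetric under k -> 2m+2-k. Hence the middle coefficient vanishes and
  the upper half folds onto k \<le> m.\<close>

lemma cbin_power_sum:
  fixes z :: "'a::comm_ring_1"
  shows "(\<Sum>k\<le>m. (-1) ^ k * of_int (cbin (2 * m) (int k) - cbin (2 * m) (int k - 2))
      * (z ^ k - z ^ (2 * m + 2 - k))) = (1 - z) ^ (2 * m) * (1 - z\<^sup>2)"
proof -
  define b where "b k = cbin (2 * m) (int k) - cbin (2 * m) (int k - 2)" for k
  define f where "f k = (-1) ^ k * of_int (b k) * z ^ k" for k
  have bin: "(1 - z) ^ (2 * m) = (\<Sum>k\<le>2 * m. (-1) ^ k * of_nat (2 * m choose k) * z ^ k)"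
    using binomial_ring[of "- z" 1 "2 * m"]
    by (simp add: power_minus[of z] ac_simps)
  have low: "(\<Sum>k\<le>2 * m + 2. (-1) ^ k * of_int (cbin (2 * m) (int k)) * z ^ k) = (1 - z) ^ (2 * m)"
    by (simp add: bin cbin_def binomial_eq_0)
  have high: "(\<Sum>k\<le>2 * m + 2. (-1) ^ k * of_int (cbin (2 * m) (int k - 2)) * z ^ k)
      = (1 - z) ^ (2 * m) * z\<^sup>2"
    by (simp only: add_2_eq_Suc' sum.atMost_Suc_shift bin)
       (simp add: cbin_def sum_distrib_left sum_distrib_right power2_eq_square nat_diff_distrib ac_simps)
  have total: "(\<Sum>k\<le>2 * m + 2. f k) = (1 - z) ^ (2 * m) * (1 - z\<^sup>2)"
    by (simp only: f_def b_def of_int_diff right_diff_distrib left_diff_distrib sum_subtractf low high mult_1_right)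
  have anti: "b (2 * m + 2 - k) = - b k" if "k \<le> 2 * m + 2" for k
  proof -
    have "cbin (2 * m) (int (2 * m + 2 - k)) = cbin (2 * m) (int k - 2)"
    proof (cases "k < 2")
      case False
      then have "nat (int k - 2) = k - 2" by auto
      then show ?thesis
        unfolding cbin_def nat_int
        using False that binomial_symmetric[of "k - 2" "2 * m"] by simp
    qed (simp add: cbin_def)
    moreover have "cbin (2 * m) (int (2 * m + 2 - k) - 2) = cbin (2 * m) (int k)"
    proof (cases "k \<le> 2 * m")
      case True
      then have "nat (int (2 * m + 2 - k) - 2) = 2 * m - k" by auto
      then show ?thesis
        using True binomial_symmetric[of k "2 * m"] by (simp add: cbin_def)
    qed (use that in \<open>simp add: cbin_def\<close>)
    ultimately show ?thesis by (simp add: b_def)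
  qed
  have "{..2 * m + 2} = {..m} \<union> {Suc m} \<union> {m + 2..2 * m + 2}" by auto
  then have "(\<Sum>k\<le>2 * m + 2. f k) = (\<Sum>k\<le>m. f k) + f (Suc m) + (\<Sum>k=m+2..2*m+2. f k)"
    by (simp only:) (subst sum.union_disjoint; simp; subst sum.union_disjoint; simp)
  also have "f (Suc m) = 0"
    using anti[of "Suc m"] by (simp add: f_def)
  also have "(\<Sum>k=m+2..2*m+2. f k) = (\<Sum>k\<le>m. f (2 * m + 2 - k))"
    by (rule sum.reindex_bij_witness[of _ "\<lambda>k. 2 * m + 2 - k" "\<lambda>k. 2 * m + 2 - k"]) auto
  also have "\<dots> = (\<Sum>k\<le>m. - ((-1) ^ k * of_int (b k) * z ^ (2 * m + 2 - k)))"
  proof (rule sum.cong)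
    fix k assume "k \<in> {..m}"
    then have "even (2 * m + 2 - k) = even k" and "k \<le> 2 * m + 2" by auto
    then show "f (2 * m + 2 - k) = - ((-1) ^ k * of_int (b k) * z ^ (2 * m + 2 - k))"
      by (simp only: f_def anti minus_one_power_iff) simp
  qed simp
  finally have "(1 - z) ^ (2 * m) * (1 - z\<^sup>2)
      = (\<Sum>k\<le>m. f k) + 0 + (\<Sum>k\<le>m. - ((-1) ^ k * of_int (b k) * z ^ (2 * m + 2 - k)))"
    by (simp only: total)
  then show ?thesis
    by (simp only: f_def b_def right_diff_distrib sum_subtractf sum_negf) simp
qed

text \<open>Both parts of the sum are geometric: 1 + ... + a^(N-1), and a^(N+1) times the same. With
  a = y^n this divides out the denominator 1 - y^n once x = y^N.\<close>

lemma power_diff_product_sum: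
  fixes a :: "'a::comm_ring_1"
  shows "(1 - a ^ N) * (1 - a ^ Suc N) = (1 - a) * (\<Sum>l=1..N. a ^ (N - l) - a ^ (N + l))"
proof -
  have "(\<Sum>l=1..N. a ^ (N - l)) = (\<Sum>i<N. a ^ i)"
    by (rule sum.reindex_bij_witness[of _ "\<lambda>i. N - i" "\<lambda>l. N - l"]) auto
  moreover have "(\<Sum>l=1..N. a ^ (N + l)) = (\<Sum>i<N. a ^ i) * a ^ Suc N"
    by (simp only: sum_distrib_right, rule sum.reindex_bij_witness[of _ "\<lambda>i. Suc i" "\<lambda>l. l - 1"])
       (auto simp: add.commute simp del: power_Suc simp flip: power_add)
  ultimately have "(\<Sum>l=1..N. a ^ (N - l) - a ^ (N + l)) = (\<Sum>i<N. a ^ i) * (1 - a ^ Suc N)"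
    by (simp add: sum_subtractf algebra_simps)
  then show ?thesis
    by (simp add: one_diff_power_eq mult.assoc)
qed

text \<open>Here \<open>d k\<close> plays the role of D/(1 - y^(m+1-k)), which keeps the statement
  free of division. At x = y^N each summand becomes D times a sum over l by
  \<open>power_diff_product_sum\<close>; after exchanging the sums, \<open>cbin_power_sum\<close>
  applies with z = y^l.\<close>

lemma faulhaber_sum:
  fixes y :: "'a::comm_ring_1"
  assumes "\<And>k. k \<le> m \<Longrightarrow> (1 - y ^ (m + 1 - k)) * d k = D"
  shows "(\<Sum>k\<le>m. (-1) ^ k * of_int (cbin (2 * m) (int k) - cbin (2 * m) (int k - 2)) * d k *
      ((1 - (y ^ N) ^ (m + 1 - k)) * (1 - (y ^ N) ^ (m + 1 - k) * y ^ (m + 1 - k)) * (y ^ N) ^ k))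
    = D * (\<Sum>l=1..N. y ^ ((m + 1) * (N - l)) * ((1 - y ^ l) ^ (2 * m) * (1 - (y ^ l)\<^sup>2)))"
proof -
  define c :: "nat \<Rightarrow> 'a" where "c k = (-1) ^ k * of_int (cbin (2 * m) (int k) - cbin (2 * m) (int k - 2))" for k
  have "c k * d k * ((1 - (y ^ N) ^ (m + 1 - k)) * (1 - (y ^ N) ^ (m + 1 - k) * y ^ (m + 1 - k)) * (y ^ N) ^ k)
      = D * (\<Sum>l=1..N. y ^ ((m + 1) * (N - l)) * (c k * ((y ^ l) ^ k - (y ^ l) ^ (2 * m + 2 - k))))"
    if k: "k \<le> m" for k
  proof -
    define n where "n = m + 1 - k"
    have "(1 - (y ^ N) ^ n) * (1 - (y ^ N) ^ n * y ^ n) = (1 - (y ^ n) ^ N) * (1 - (y ^ n) ^ Suc N)"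
      by (simp add: mult.commute flip: power_mult power_add)
    also have "\<dots> = (1 - y ^ n) * (\<Sum>l=1..N. (y ^ n) ^ (N - l) - (y ^ n) ^ (N + l))"
      by (rule power_diff_product_sum)
    finally have "c k * d k * ((1 - (y ^ N) ^ n) * (1 - (y ^ N) ^ n * y ^ n) * (y ^ N) ^ k)
      = ((1 - y ^ n) * d k) * (\<Sum>l=1..N. c k * (((y ^ n) ^ (N - l) - (y ^ n) ^ (N + l)) * (y ^ N) ^ k))"
      by (simp only: sum_distrib_left sum_distrib_right ac_simps)
    also have "(\<Sum>l=1..N. c k * (((y ^ n) ^ (N - l) - (y ^ n) ^ (N + l)) * (y ^ N) ^ k))
      = (\<Sum>l=1..N. y ^ ((m + 1) * (N - l)) * (c k * ((y ^ l) ^ k - (y ^ l) ^ (2 * m + 2 - k))))"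
    proof (rule sum.cong)
      fix l assume "l \<in> {1..N}"
      then obtain i where N: "N = l + i" using le_Suc_ex by auto
      have m: "m + 1 = n + k" using k by (simp add: n_def)
      \<comment> \<open>Since m + 1 = n + k, both terms share the factor y^((m+1)(N-l)), leaving z^k
        and z^(2m+2-k) for z = y^l.\<close>
      have 1: "n * (N - l) + N * k = (m + 1) * (N - l) + l * k"
        by (simp only: m) (simp add: N algebra_simps)
      have "2 * m + 2 - k = 2 * n + k" using m by linarith
      then have 2: "n * (N + l) + N * k = (m + 1) * (N - l) + l * (2 * m + 2 - k)"
        by (simp only: m) (simp add: N algebra_simps)
      show "c k * (((y ^ n) ^ (N - l) - (y ^ n) ^ (N + l)) * (y ^ N) ^ k)
        = y ^ ((m + 1) * (N - l)) * (c k * ((y ^ l) ^ k - (y ^ l) ^ (2 * m + 2 - k)))"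
        by (simp only: left_diff_distrib right_diff_distrib mult.left_commute[of _ "c k"]
              power_mult[symmetric] power_add[symmetric] 1 2)
    qed simp
    finally show ?thesis
      using assms[OF k] by (simp only: n_def)
  qed
  then have "(\<Sum>k\<le>m. c k * d k *
      ((1 - (y ^ N) ^ (m + 1 - k)) * (1 - (y ^ N) ^ (m + 1 - k) * y ^ (m + 1 - k)) * (y ^ N) ^ k))
    = (\<Sum>k\<le>m. D * (\<Sum>l=1..N. y ^ ((m + 1) * (N - l)) * (c k * ((y ^ l) ^ k - (y ^ l) ^ (2 * m + 2 - k)))))"
    by (intro sum.cong refl) (simp only: atMost_iff)
  also have "\<dots> = D * (\<Sum>k\<le>m. \<Sum>l=1..N. y ^ ((m + 1) * (N - l)) * (c k * ((y ^ l) ^ k - (y ^ l) ^ (2 * m + 2 - k))))"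
    by (simp only: sum_distrib_left)
  also have "\<dots> = D * (\<Sum>l=1..N. y ^ ((m + 1) * (N - l)) * (\<Sum>k\<le>m. c k * ((y ^ l) ^ k - (y ^ l) ^ (2 * m + 2 - k))))"
    by (subst sum.swap) (simp only: sum_distrib_left)
  finally show ?thesis
    by (simp only: c_def cbin_power_sum)
qed

lemma sum_triangle_shift:
  fixes f :: "nat \<Rightarrow> nat \<Rightarrow> 'a::comm_monoid_add"
  shows "(\<Sum>s\<le>m. \<Sum>k\<le>s. f k (s - k)) = (\<Sum>k\<le>m. \<Sum>j\<le>m - k. f k j)"
  by (simp add: sum.Sigma,
      rule sum.reindex_bij_witness[of _ "\<lambda>(k, j). (k + j, k)" "\<lambda>(s, k). (k, s - k)"]) auto

text \<open>Inserts \<open>lcoef_expansion\<close> and collects by s = k + j. The coefficients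
  \<open>c\<close> and the ring are arbitrary because it serves twice: in Z[y] at x = y^N with
  denominators cleared, and for indeterminate x with the denominators inside
  \<open>c\<close>.\<close>

lemma expansion_regrouped:
  fixes x y :: "'a::comm_ring_1"
  shows "(\<Sum>k\<le>m. c k * ((1 - x ^ (m + 1 - k)) * (1 - x ^ (m + 1 - k) * y ^ (m + 1 - k)) * x ^ k))
    = (\<Sum>s\<le>m. (\<Sum>k\<le>s. c k * lcoef (m - k) (s - k) y) * x ^ s * ((1 - x) * (1 - x * y)) ^ (m + 1 - s))"
proof -
  define u where "u = (1 - x) * (1 - x * y)"
  have "(\<Sum>k\<le>m. c k * ((1 - x ^ (m + 1 - k)) * (1 - x ^ (m + 1 - k) * y ^ (m + 1 - k)) * x ^ k))
    = (\<Sum>k\<le>m. \<Sum>j\<le>m - k. c k * lcoef (m - k) j y * x ^ (k + j) * u ^ (m + 1 - (k + j)))"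
  proof (rule sum.cong)
    fix k assume "k \<in> {..m}"
    then have e: "m + 1 - k = Suc (m - k)" by auto
    have "c k * ((1 - x ^ (m + 1 - k)) * (1 - x ^ (m + 1 - k) * y ^ (m + 1 - k)) * x ^ k)
      = (\<Sum>j\<le>m - k. c k * (lcoef (m - k) j y * x ^ j * u ^ (Suc (m - k) - j)) * x ^ k)"
      unfolding e lcoef_expansion u_def by (simp only: sum_distrib_left sum_distrib_right mult.assoc)
    also have "\<dots> = (\<Sum>j\<le>m - k. c k * lcoef (m - k) j y * x ^ (k + j) * u ^ (m + 1 - (k + j)))"
      using e by (intro sum.cong) (simp_all add: power_add ac_simps)
    finally show "c k * ((1 - x ^ (m + 1 - k)) * (1 - x ^ (m + 1 - k) * y ^ (m + 1 - k)) * x ^ k)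
      = (\<Sum>j\<le>m - k. c k * lcoef (m - k) j y * x ^ (k + j) * u ^ (m + 1 - (k + j)))" .
  qed simp
  also have "\<dots> = (\<Sum>s\<le>m. \<Sum>k\<le>s. c k * lcoef (m - k) (s - k) y * x ^ (k + (s - k)) * u ^ (m + 1 - (k + (s - k))))"
    by (rule sum_triangle_shift[symmetric])
  also have "\<dots> = (\<Sum>s\<le>m. (\<Sum>k\<le>s. c k * lcoef (m - k) (s - k) y) * x ^ s * u ^ (m + 1 - s))"
    by (simp add: sum_distrib_right)
  finally show ?thesis by (simp only: u_def)
qed

section \<open>Divisibility by powers of 1 - y in Z[y]\<close>

definition yvar :: "int poly" where "yvar = [:0, 1:]"

lemma poly_yvar [simp]: "poly yvar c = c"
  by (simp add: yvar_def)

lemma one_minus_yvar_dvd_iff: "1 - yvar dvd p \<longleftrightarrow> poly p 1 = 0"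
proof -
  have "1 - yvar = - [:-1, 1:]" by (simp add: yvar_def one_pCons)
  then show ?thesis by (simp only: minus_dvd_iff poly_eq_0_iff_dvd)
qed

lemma one_minus_yvar_nonzero [simp]: "1 - yvar \<noteq> 0"
  by (simp add: yvar_def one_pCons)

text \<open>Divisibility by 1 - y means vanishing at 1, so 1 - y is prime, and a factor not
  vanishing at 1 can be stripped one power at a time.\<close>

lemma one_minus_yvar_power_dvd_cancel:
  assumes "(1 - yvar) ^ a dvd q * r" and "poly r 1 \<noteq> 0"
  shows "(1 - yvar) ^ a dvd q"
  using assms(1)
proof (induction a)
  case (Suc a)
  have "(1 - yvar) ^ a dvd q"
    by (rule Suc.IH, rule power_le_dvd[OF Suc.prems]) simp
  then obtain v where v: "q = (1 - yvar) ^ a * v" ..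
  then have "(1 - yvar) ^ a * (1 - yvar) dvd (1 - yvar) ^ a * (v * r)"
    using Suc.prems by (simp only: power_Suc2 mult.assoc)
  then have "1 - yvar dvd v * r"
    by (simp only: dvd_mult_cancel_left power_not_zero[OF one_minus_yvar_nonzero] simp_thms)
  then have "1 - yvar dvd v"
    using assms(2) by (simp add: one_minus_yvar_dvd_iff)
  then show ?case
    unfolding v power_Suc2 by (rule mult_dvd_mono[OF dvd_refl])
qed simp

text \<open>
  After a common power of 1 - y has been divided out, evaluation at y = 1 gives a polynomial in
  N(N+1) that vanishes for all N > 0; hence the next power of 1 - y can be divided out as well.
\<close>

lemma one_minus_yvar_power_dvd_all:
  fixes U :: "nat \<Rightarrow> int poly" and G :: "nat \<Rightarrow> nat \<Rightarrow> int poly"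
  assumes G: "\<And>N s. s \<le> m \<Longrightarrow> poly (G N s) 1 = (int N * (int N + 1)) ^ (m + 1 - s)"
    and "\<And>N. 0 < N \<Longrightarrow> (1 - yvar) ^ K dvd (\<Sum>s\<le>m. U s * G N s)"
    and "s \<le> m"
  shows "(1 - yvar) ^ K dvd U s"
  using assms(2,3)
proof (induction K arbitrary: s)
  case (Suc K)
  have "\<exists>v. U s = (1 - yvar) ^ K * v" if "s \<le> m" for s
    using Suc.IH[OF power_le_dvd[OF Suc.prems(1)] that] by (auto simp: dvd_def)
  then obtain V where V: "\<And>s. s \<le> m \<Longrightarrow> U s = (1 - yvar) ^ K * V s"
    by metis
  \<comment> \<open>The quotient sum evaluated at y = 1, read as a polynomial in z = N(N+1).\<close>
  define P where "P = (\<Sum>s\<le>m. monom (poly (V s) 1) (m + 1 - s))"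
  have root: "poly P (int N * (int N + 1)) = 0" if "0 < N" for N
  proof -
    have "(\<Sum>s\<le>m. U s * G N s) = (1 - yvar) ^ K * (\<Sum>s\<le>m. V s * G N s)"
      by (simp add: sum_distrib_left V mult.assoc)
    then have "(1 - yvar) ^ K * (1 - yvar) dvd (1 - yvar) ^ K * (\<Sum>s\<le>m. V s * G N s)"
      using Suc.prems(1)[OF that] by (simp only: power_Suc2)
    then have "1 - yvar dvd (\<Sum>s\<le>m. V s * G N s)"
      by (simp only: dvd_mult_cancel_left power_not_zero[OF one_minus_yvar_nonzero] simp_thms)
    then show ?thesis
      by (simp add: one_minus_yvar_dvd_iff P_def poly_sum poly_monom G)
  qed
  have "P = 0"
  proof (rule ccontr)
    assume "P \<noteq> 0"
    then have "finite {z. poly P z = 0}" by (rule poly_roots_finite)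
    moreover have "(\<lambda>N. int N * (int N + 1)) ` {0<..} \<subseteq> {z. poly P z = 0}"
      using root by auto
    moreover have "inj_on (\<lambda>N. int N * (int N + 1)) {0<..}"
    proof (rule linorder_inj_onI)
      fix M N :: nat assume "M < N"
      then have "int M * (int M + 1) < int N * (int N + 1)"
        by (intro mult_strict_mono) auto
      then show "int M * (int M + 1) \<noteq> int N * (int N + 1)" by simp
    qed auto
    ultimately have "finite {0::nat<..}"
      using finite_imageD finite_subset by blast
    then show False by (simp add: infinite_Ioi)
  qed
  \<comment> \<open>For s \<le> m the exponents m + 1 - s are distinct, so each coefficient of
    \<open>P\<close> is a single value \<open>poly (V s) 1\<close>.\<close>
  have "coeff P (m + 1 - s) = (\<Sum>t\<le>m. if t = s then poly (V t) 1 else 0)"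
    unfolding P_def coeff_sum coeff_monom
    using Suc.prems(2) by (intro sum.cong) auto
  then have "poly (V s) 1 = 0"
    using \<open>P = 0\<close> Suc.prems(2) by simp
  then show ?case
    unfolding V[OF Suc.prems(2)] power_Suc2
    by (intro mult_dvd_mono dvd_refl) (simp add: one_minus_yvar_dvd_iff)
qed simp

text \<open>The product in \<open>Pms\<close> multiplied into its sum, each 1 - y^(m+1-k) cancelled
  against its factor; this stays in Z[y]. By \<open>Pms_numer\<close>, \<open>Pms m s\<close> is
  this over (1 - y)^(3s), up to the sign (-1)^s.\<close>

definition numer :: "nat \<Rightarrow> nat \<Rightarrow> int poly" where
  "numer m s = (\<Sum>k\<le>s. (-1) ^ k * of_int (cbin (2 * m) (int k) - cbin (2 * m) (int k - 2))
     * (\<Prod>i\<in>{..s} - {k}. 1 - yvar ^ (m + 1 - i)) * lcoef (m - k) (s - k) yvar)"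

text \<open>Counting orders at y = 1: clearing all denominators by \<open>D\<close> contributes m+1
  and the Faulhaber-type sum 2m+1, together 3m+2. The power u^(m+1-s) accounts for 2(m+1-s), so
  \<open>T s\<close> has order at least m+2s. Of this, m-s comes from the factors 1 - y^(m+1-i) with
  s < i \<le> m, leaving 3s for \<open>numer m s\<close>.\<close>

lemma one_minus_yvar_power_dvd_numer:
  assumes "s \<le> m"
  shows "(1 - yvar) ^ (3 * s) dvd numer m s"
proof -
  define c :: "nat \<Rightarrow> int poly"
    where "c k = (-1) ^ k * of_int (cbin (2 * m) (int k) - cbin (2 * m) (int k - 2))" for k
  define w where "w i = 1 - yvar ^ (m + 1 - i)" for i
  \<comment> \<open>All i \<le> m are needed here, not only i \<le> s, since one identity involves
    every s at once.\<close>
  define d where "d k = (\<Prod>i\<in>{..m} - {k}. w i)" for k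
  define D where "D = (\<Prod>i\<le>m. w i)"
  define T where "T s = (\<Sum>k\<le>s. c k * d k * lcoef (m - k) (s - k) yvar)" for s
  \<comment> \<open>This is (1 - y^N)(1 - y^(N+1))/(1 - y)^2, with value N(N+1) at y = 1.\<close>
  define E where "E N = (\<Sum>i<N. yvar ^ i) * (\<Sum>i<Suc N. yvar ^ i)" for N
  define G where "G N s = (yvar ^ N) ^ s * E N ^ (m + 1 - s)" for N s
  have wd: "(1 - yvar ^ (m + 1 - k)) * d k = D" if "k \<le> m" for k
    using prod.remove[of "{..m}" k w] that by (simp add: d_def D_def w_def)
  have dvd_power: "1 - yvar dvd 1 - yvar ^ n" for n
    by (simp add: one_minus_yvar_dvd_iff)
  have "(1 - yvar) ^ (m + 1) dvd D"
    using prod_dvd_prod[of "{..m}" "\<lambda>_. 1 - yvar" w] by (simp add: D_def w_def dvd_power)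
  moreover have "(1 - yvar) ^ (2 * m) * (1 - yvar) dvd (1 - yvar ^ l) ^ (2 * m) * (1 - (yvar ^ l)\<^sup>2)" for l
    by (intro mult_dvd_mono dvd_power_same) (simp_all add: dvd_power flip: power_mult)
  then have "(1 - yvar) ^ (2 * m) * (1 - yvar) dvd
      (\<Sum>l=1..N. yvar ^ ((m + 1) * (N - l)) * ((1 - yvar ^ l) ^ (2 * m) * (1 - (yvar ^ l)\<^sup>2)))" for N
    by (intro dvd_sum dvd_mult[of _ "(1 - yvar ^ l) ^ (2 * m) * (1 - (yvar ^ l)\<^sup>2)" for l])
  ultimately have "(1 - yvar) ^ (m + 1) * ((1 - yvar) ^ (2 * m) * (1 - yvar)) dvd D *
      (\<Sum>l=1..N. yvar ^ ((m + 1) * (N - l)) * ((1 - yvar ^ l) ^ (2 * m) * (1 - (yvar ^ l)\<^sup>2)))" for N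
    by (intro mult_dvd_mono)
  moreover have "(1 - yvar) ^ (m + 1) * ((1 - yvar) ^ (2 * m) * (1 - yvar)) = (1 - yvar) ^ (3 * m + 2)"
    by (simp only: power_add[symmetric] power_Suc2[symmetric]) (simp add: algebra_simps)
  ultimately have dvd_lhs: "(1 - yvar) ^ (3 * m + 2) dvd
      (\<Sum>s\<le>m. T s * (yvar ^ N) ^ s * ((1 - yvar ^ N) * (1 - yvar ^ N * yvar)) ^ (m + 1 - s))" for N
    unfolding T_def expansion_regrouped[symmetric]
    by (simp only: c_def faulhaber_sum[OF wd])
  have E: "(1 - yvar ^ N) * (1 - yvar ^ N * yvar) = (1 - yvar)\<^sup>2 * E N" for N
  proof -
    have "(1 - yvar ^ N) * (1 - yvar ^ N * yvar) = (1 - yvar ^ N) * (1 - yvar ^ Suc N)"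
      by (simp add: mult.commute)
    then show ?thesis
      by (simp only: E_def one_diff_power_eq power2_eq_square ac_simps)
  qed
  have "(\<Sum>s\<le>m. T s * (yvar ^ N) ^ s * ((1 - yvar ^ N) * (1 - yvar ^ N * yvar)) ^ (m + 1 - s))
      = (\<Sum>s\<le>m. (T s * (1 - yvar) ^ (2 * (m + 1 - s))) * G N s)" for N
    unfolding E by (simp only: G_def power_mult_distrib power_mult ac_simps)
  then have "(1 - yvar) ^ (3 * m + 2) dvd (\<Sum>s\<le>m. (T s * (1 - yvar) ^ (2 * (m + 1 - s))) * G N s)" for N
    using dvd_lhs by simp
  moreover have "poly (G N s) 1 = (int N * (int N + 1)) ^ (m + 1 - s)" for N s
    by (simp add: G_def E_def poly_sum algebra_simps)
  ultimately have "(1 - yvar) ^ (3 * m + 2) dvd T s * (1 - yvar) ^ (2 * (m + 1 - s))"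
    using assms
    by - (rule one_minus_yvar_power_dvd_all[where G = G and U = "\<lambda>s. T s * (1 - yvar) ^ (2 * (m + 1 - s))"])
  moreover have "3 * m + 2 = (m + 2 * s) + 2 * (m + 1 - s)"
    using assms by simp
  ultimately have "(1 - yvar) ^ (m + 2 * s) dvd T s"
    by (simp only: power_add dvd_mult_cancel_right power_not_zero[OF one_minus_yvar_nonzero] simp_thms)
  moreover have "T s = numer m s * (\<Prod>i\<in>{s<..m}. w i)"
  proof -
    have "d k = (\<Prod>i\<in>{..s} - {k}. w i) * (\<Prod>i\<in>{s<..m}. w i)" if "k \<le> s" for k
    proof -
      have "{..m} - {k} = ({..s} - {k}) \<union> {s<..m}" using assms that by auto
      moreover have "({..s} - {k}) \<inter> {s<..m} = {}" by auto
      ultimately show ?thesis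
        by (simp only: d_def prod.union_disjoint finite_Diff finite_atMost finite_greaterThanAtMost)
    qed
    then have "T s = (\<Sum>k\<le>s. c k * (\<Prod>i\<in>{..s} - {k}. w i) * lcoef (m - k) (s - k) yvar
        * (\<Prod>i\<in>{s<..m}. w i))"
      unfolding T_def by (intro sum.cong refl) (simp only: atMost_iff ac_simps)
    then show ?thesis
      by (simp only: numer_def c_def w_def sum_distrib_right)
  qed
  moreover have "(\<Prod>i\<in>{s<..m}. w i) = (1 - yvar) ^ (m - s) * (\<Prod>i\<in>{s<..m}. \<Sum>j<m + 1 - i. yvar ^ j)"
    by (simp only: w_def one_diff_power_eq prod.distrib prod_constant card_greaterThanAtMost)
  moreover have "m + 2 * s = (m - s) + 3 * s"
    using assms by simp
  ultimately have "(1 - yvar) ^ (m - s) * (1 - yvar) ^ (3 * s) dvd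
      (1 - yvar) ^ (m - s) * (numer m s * (\<Prod>i\<in>{s<..m}. \<Sum>j<m + 1 - i. yvar ^ j))"
    by (simp only: power_add mult.left_commute)
  then have "(1 - yvar) ^ (3 * s) dvd numer m s * (\<Prod>i\<in>{s<..m}. \<Sum>j<m + 1 - i. yvar ^ j)"
    by (simp only: dvd_mult_cancel_left power_not_zero[OF one_minus_yvar_nonzero] simp_thms)
  \<comment> \<open>The remaining product has the value (m+1-i) multiplied over s < i \<le> m at y =
    1, which is nonzero.\<close>
  then show ?thesis
    by (rule one_minus_yvar_power_dvd_cancel) (auto simp: poly_prod poly_sum)
qed

section \<open>Embedding Z[y] into the rational functions\<close>

lemma ypoly_0 [simp]: "ypoly 0 = 0" and ypoly_1 [simp]: "ypoly 1 = 1"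
  by (simp_all add: ypoly_def Zero_fract_def One_fract_def one_pCons map_poly_pCons)

lemma ypoly_add: "ypoly (p + q) = ypoly p + ypoly q"
proof -
  have "map_poly of_int (p + q) = map_poly of_int p + (map_poly of_int q :: rat poly)"
    by (rule poly_eqI) (simp add: coeff_map_poly)
  then show ?thesis by (simp add: ypoly_def)
qed

lemma ypoly_mult: "ypoly (p * q) = ypoly p * ypoly q"
proof -
  have "map_poly of_int (p * q) = map_poly of_int p * (map_poly of_int q :: rat poly)"
    by (rule poly_eqI) (simp add: coeff_map_poly coeff_mult)
  then show ?thesis by (simp add: ypoly_def mult.commute)
qed

lemma ypoly_diff: "ypoly (p - q) = ypoly p - ypoly q"
  using ypoly_add[of "p - q" q] by simp

lemma ypoly_minus: "ypoly (- p) = - ypoly p"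
  using ypoly_diff[of 0 p] by simp

lemma ypoly_power: "ypoly (p ^ n) = ypoly p ^ n"
  by (induction n) (simp_all add: ypoly_mult)

lemma ypoly_sum: "ypoly (sum f A) = (\<Sum>a\<in>A. ypoly (f a))"
  by (induction A rule: infinite_finite_induct) (simp_all add: ypoly_add)

lemma ypoly_prod: "ypoly (prod f A) = (\<Prod>a\<in>A. ypoly (f a))"
  by (induction A rule: infinite_finite_induct) (simp_all add: ypoly_mult)

lemma ypoly_of_nat: "ypoly (of_nat n) = of_nat n"
  by (induction n) (simp_all add: ypoly_add)

lemma ypoly_of_int: "ypoly (of_int z) = of_int z"
  by (cases z rule: int_diff_cases) (simp add: ypoly_diff ypoly_of_nat)

lemma ypoly_yvar: "ypoly yvar = Yv"
  by (simp add: ypoly_def yvar_def Yv_def map_poly_pCons)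

lemmas ypoly_hom = ypoly_add ypoly_mult ypoly_diff ypoly_minus ypoly_power ypoly_sum
  ypoly_prod ypoly_of_nat ypoly_of_int ypoly_yvar

lemma ypoly_eq_0_iff: "ypoly p = 0 \<longleftrightarrow> p = 0"
  by (simp add: ypoly_def Zero_fract_def eq_fract) (simp add: poly_eq_iff coeff_map_poly)

lemma of_nat_ratfun2_nonzero:
  assumes "0 < n"
  shows "(of_nat n :: ratfun2) \<noteq> 0"
  using assms by (simp add: ypoly_eq_0_iff flip: ypoly_of_nat)

lemma one_minus_Yv_power_nonzero:
  assumes "0 < n"
  shows "1 - Yv ^ n \<noteq> 0"
proof -
  \<comment> \<open>The value 1 - 2^n at y = 2 is negative.\<close>
  have "poly (1 - yvar ^ n) 2 \<noteq> 0"
    using assms one_less_power[of "2::int" n] by simp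
  then have "ypoly (1 - yvar ^ n) \<noteq> 0"
    unfolding ypoly_eq_0_iff by (metis poly_0)
  then show ?thesis by (simp add: ypoly_hom)
qed

section \<open>\<open>Pms\<close> in terms of \<open>lcoef\<close> and \<open>numer\<close>\<close>

text \<open>With q = p - j and l = j - i, split p + 1 = (q + i + 1) + l. Absorption turns (q+i+1)
  C(q+i,i) into (q+1) C(q+1+i,i) and l C(q+l,l) into (q+1) C(q+l,q+1), so q + 1 divides both
  parts.\<close>

lemma lcoef_binomial_identity:
  assumes "i \<le> j" and "j \<le> p"
  shows "Suc p * ((p - j + i choose i) * (p - i choose (j - i))) =
    Suc (p - j) * ((Suc (p - j) + i choose i) * (p - i choose (j - i))
      + (p - j + i choose i) * (p - i choose Suc (p - j)))"
proof -
  define q l where "q = p - j" and "l = j - i"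
  have p: "p = q + i + l" and pi: "p - i = q + l"
    using assms by (simp_all add: q_def l_def)
  have a: "Suc q * (Suc q + i choose i) = Suc (q + i) * (q + i choose i)"
    using Suc_times_binomial[of q "q + i"] binomial_symmetric[of i "q + i"]
      binomial_symmetric[of i "Suc q + i"] by simp
  have b: "Suc q * (q + l choose Suc q) = l * (q + l choose l)"
    using Suc_times_binomial[of q "q + l"] binomial_symmetric[of l "q + l"]
    by (simp add: algebra_simps)
  have "Suc q * ((Suc q + i choose i) * (q + l choose l) + (q + i choose i) * (q + l choose Suc q))
    = (Suc q * (Suc q + i choose i)) * (q + l choose l) + (q + i choose i) * (Suc q * (q + l choose Suc q))"
    by (simp only: distrib_left ac_simps)
  also have "\<dots> = Suc (q + i + l) * ((q + i choose i) * (q + l choose l))"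
    unfolding a b by (simp add: algebra_simps)
  finally show ?thesis
    unfolding pi q_def[symmetric] l_def[symmetric] by (simp only: p)
qed

lemma lcoef_Yv:
  assumes "j \<le> p"
  shows "(\<Sum>i=0..j. of_nat (p + 1) / of_nat (p - j + 1) * of_nat (p - j + i choose i)
    * of_nat (p - i choose (j - i)) * Yv ^ (j - i)) = lcoef p j Yv"
  unfolding lcoef_def
proof (rule sum.cong)
  have cancel: "u / v * a * b * z = c * z" if "u * (a * b) = v * c" "v \<noteq> 0" for u v a b c z :: ratfun2
    using that by (simp add: field_simps)
  fix i assume "i \<in> {..j}"
  then have "of_nat (Suc p) * (of_nat (p - j + i choose i) * of_nat (p - i choose (j - i))) =
    (of_nat (Suc (p - j)) :: ratfun2) * of_nat ((Suc (p - j) + i choose i) * (p - i choose (j - i))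
      + (p - j + i choose i) * (p - i choose Suc (p - j)))"
    using lcoef_binomial_identity[of i j p] assms by (simp only: flip: of_nat_mult) auto
  then show "of_nat (p + 1) / of_nat (p - j + 1) * of_nat (p - j + i choose i)
    * of_nat (p - i choose (j - i)) * Yv ^ (j - i) =
    of_nat ((Suc (p - j) + i choose i) * (p - i choose (j - i))
      + (p - j + i choose i) * (p - i choose Suc (p - j))) * Yv ^ (j - i)"
    unfolding Suc_eq_plus1[symmetric] by (rule cancel) (rule of_nat_ratfun2_nonzero, simp)
qed auto

lemma Pms_lcoef:
  assumes "s \<le> m"
  shows "Pms m s = (-1) ^ s * (\<Prod>i=0..s. 1 - Yv ^ (m + 1 - i)) / (1 - Yv) ^ (3 * s) *
    (\<Sum>k\<le>s. ((-1) ^ k * of_int (cbin (2 * m) (int k) - cbin (2 * m) (int k - 2)) / (1 - Yv ^ (m + 1 - k)))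
      * lcoef (m - k) (s - k) Yv)"
proof -
  have "(-1) ^ (s - k) / (1 - Yv ^ (m + 1 - k)) *
        of_int (cbin (2 * m) (int k) - cbin (2 * m) (int k - 2)) *
        (\<Sum>i=0..s-k. of_nat (m - k + 1) / of_nat (m - s + 1) *
            of_nat ((m - s + i) choose i) * of_nat ((m - k - i) choose (s - k - i)) *
            Yv ^ (s - k - i))
      = (-1) ^ s * (((-1) ^ k * of_int (cbin (2 * m) (int k) - cbin (2 * m) (int k - 2)) / (1 - Yv ^ (m + 1 - k)))
      * lcoef (m - k) (s - k) Yv)" if "k \<le> s" for k
  proof -
    \<comment> \<open>For p = m - k and j = s - k the denominator p - j + 1 is m - s + 1, as in
      \<open>Pms\<close>.\<close>
    have "m - k - (s - k) = m - s" using that by simp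
    then have "(\<Sum>i=0..s-k. of_nat (m - k + 1) / of_nat (m - s + 1) *
            of_nat ((m - s + i) choose i) * of_nat ((m - k - i) choose (s - k - i)) *
            Yv ^ (s - k - i)) = lcoef (m - k) (s - k) Yv"
      using lcoef_Yv[of "s - k" "m - k"] assms by simp
    moreover have "(-1 :: ratfun2) ^ (s - k) = (-1) ^ s * (-1) ^ k"
      using that by (simp add: minus_one_power_iff)
    ultimately show ?thesis by (simp only:) (simp only: times_divide_eq_left times_divide_eq_right mult.assoc)
  qed
  then have "Pms m s = (\<Prod>i=0..s. 1 - Yv ^ (m + 1 - i)) / (1 - Yv) ^ (3 * s) *
    (\<Sum>k\<le>s. (-1) ^ s * (((-1) ^ k * of_int (cbin (2 * m) (int k) - cbin (2 * m) (int k - 2)) / (1 - Yv ^ (m + 1 - k)))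
      * lcoef (m - k) (s - k) Yv))"
    unfolding Pms_def atLeast0AtMost[of s]
    by (subst sum.cong[OF refl]) (simp_all only: atMost_iff)
  then show ?thesis
    by (simp only: sum_distrib_left[symmetric]) (simp add: mult.assoc)
qed

lemma Pms_numer:
  assumes "s \<le> m"
  shows "Pms m s = (-1) ^ s * ypoly (numer m s) / (1 - Yv) ^ (3 * s)"
proof -
  define c :: "nat \<Rightarrow> ratfun2"
    where "c k = (-1) ^ k * of_int (cbin (2 * m) (int k) - cbin (2 * m) (int k - 2))" for k
  define w where "w i = 1 - Yv ^ (m + 1 - i)" for i
  have "(\<Prod>i=0..s. w i) * (\<Sum>k\<le>s. (c k / w k) * lcoef (m - k) (s - k) Yv)
    = (\<Sum>k\<le>s. c k * (\<Prod>i\<in>{..s} - {k}. w i) * lcoef (m - k) (s - k) Yv)"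
    unfolding sum_distrib_left
  proof (rule sum.cong)
    fix k assume k: "k \<in> {..s}"
    then have "w k \<noteq> 0"
      using assms one_minus_Yv_power_nonzero[of "m + 1 - k"] by (simp add: w_def)
    moreover have "(\<Prod>i=0..s. w i) = w k * (\<Prod>i\<in>{..s} - {k}. w i)"
      using k by (simp add: atLeast0AtMost prod.remove)
    ultimately show "(\<Prod>i=0..s. w i) * ((c k / w k) * lcoef (m - k) (s - k) Yv)
        = c k * (\<Prod>i\<in>{..s} - {k}. w i) * lcoef (m - k) (s - k) Yv"
      by simp
  qed simp
  \<comment> \<open>The coefficients of \<open>lcoef\<close> are natural numbers, so
    \<open>ypoly\<close> carries it over term by term.\<close>
  also have "\<dots> = ypoly (numer m s)"
    by (simp only: numer_def lcoef_def c_def w_def ypoly_hom ypoly_1)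
  finally show ?thesis
    unfolding Pms_lcoef[OF assms] c_def w_def
    by (subst mult.assoc[symmetric] times_divide_eq_left)+ simp
qed

section \<open>Integrality of \<open>Pms\<close> and the identity in x and y\<close>

theorem theorem3p1:
  fixes m :: nat
  shows "(\<forall>s \<le> m. \<exists>p :: int poly. Pms m s = ypoly p) \<and>
    (\<Sum>k=0..m. (-1) ^ k * of_int (cbin (2 * m) (int k) - cbin (2 * m) (int k - 2)) *
        ((1 - Xv ^ (m + 1 - k)) * (1 - Xv ^ (m + 1 - k) * Yv ^ (m + 1 - k)) * Xv ^ k)
        / (1 - Yv ^ (m + 1 - k)))
    = (\<Sum>k=0..m. (-1) ^ k * Pms m k *
        ((1 - Xv) ^ (m + 1 - k) * (1 - Xv * Yv) ^ (m + 1 - k) * (1 - Yv) ^ (3 * k) * Xv ^ k)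
        / (\<Prod>i=0..k. 1 - Yv ^ (m + 1 - i)))"
proof (intro conjI allI impI)
  fix s assume s: "s \<le> m"
  then obtain q where q: "numer m s = (1 - yvar) ^ (3 * s) * q"
    using one_minus_yvar_power_dvd_numer by (auto simp: dvd_def)
  have "1 - Yv \<noteq> 0"
    using one_minus_Yv_power_nonzero[of 1] by simp
  then have "Pms m s = ypoly ((-1) ^ s * q)"
    by (simp add: Pms_numer[OF s] q ypoly_hom)
  then show "\<exists>p. Pms m s = ypoly p" ..
next
  \<comment> \<open>The denominators are absorbed into \<open>c\<close>, so
    \<open>expansion_regrouped\<close> applies to the indeterminates directly.\<close>
  define c :: "nat \<Rightarrow> ratfun2"
    where "c k = (-1) ^ k * of_int (cbin (2 * m) (int k) - cbin (2 * m) (int k - 2)) / (1 - Yv ^ (m + 1 - k))" for k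
  have "(\<Sum>k=0..m. (-1) ^ k * of_int (cbin (2 * m) (int k) - cbin (2 * m) (int k - 2)) *
        ((1 - Xv ^ (m + 1 - k)) * (1 - Xv ^ (m + 1 - k) * Yv ^ (m + 1 - k)) * Xv ^ k)
        / (1 - Yv ^ (m + 1 - k)))
    = (\<Sum>k\<le>m. c k * ((1 - Xv ^ (m + 1 - k)) * (1 - Xv ^ (m + 1 - k) * Yv ^ (m + 1 - k)) * Xv ^ k))"
    by (simp only: c_def times_divide_eq_left atLeast0AtMost)
  also have "\<dots> = (\<Sum>s\<le>m. (\<Sum>k\<le>s. c k * lcoef (m - k) (s - k) Yv) * Xv ^ s *
      ((1 - Xv) * (1 - Xv * Yv)) ^ (m + 1 - s))"
    by (rule expansion_regrouped)
  also have "\<dots> = (\<Sum>s=0..m. (-1) ^ s * Pms m s *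
        ((1 - Xv) ^ (m + 1 - s) * (1 - Xv * Yv) ^ (m + 1 - s) * (1 - Yv) ^ (3 * s) * Xv ^ s)
        / (\<Prod>i=0..s. 1 - Yv ^ (m + 1 - i)))"
    unfolding atLeast0AtMost[of m]
  proof (rule sum.cong)
    fix s assume "s \<in> {..m}"
    then have s: "s \<le> m" by simp
    define S P where "S = (\<Sum>k\<le>s. c k * lcoef (m - k) (s - k) Yv)"
      and "P = (\<Prod>i=0..s. 1 - Yv ^ (m + 1 - i))"
    define Z where "Z = (1 - Yv) ^ (3 * s)"
    have Pms: "Pms m s = (-1) ^ s * P / Z * S"
      using Pms_lcoef[OF s] by (simp only: S_def P_def Z_def c_def)
    have "P \<noteq> 0"
      using s one_minus_Yv_power_nonzero by (auto simp: P_def)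
    moreover have "Z \<noteq> 0"
      using one_minus_Yv_power_nonzero[of 1] by (simp add: Z_def)
    \<comment> \<open>The sign (-1)^s inside \<open>Pms m s\<close> meets the one in front of it,
      while \<open>P\<close> and \<open>Z\<close> cancel.\<close>
    moreover have "(-1 :: ratfun2) ^ s * (-1) ^ s = 1"
      by (simp flip: power_mult_distrib)
    ultimately have "(-1) ^ s * Pms m s * (A * B * Z * C) / P = S * C * (A * B)" for A B C
      unfolding Pms by (simp add: field_simps)
    then show "S * Xv ^ s * ((1 - Xv) * (1 - Xv * Yv)) ^ (m + 1 - s) = (-1) ^ s * Pms m s *
        ((1 - Xv) ^ (m + 1 - s) * (1 - Xv * Yv) ^ (m + 1 - s) * Z * Xv ^ s) / P"
      by (simp only: power_mult_distrib)
  qed simp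
  finally show "(\<Sum>k=0..m. (-1) ^ k * of_int (cbin (2 * m) (int k) - cbin (2 * m) (int k - 2)) *
        ((1 - Xv ^ (m + 1 - k)) * (1 - Xv ^ (m + 1 - k) * Yv ^ (m + 1 - k)) * Xv ^ k)
        / (1 - Yv ^ (m + 1 - k)))
    = (\<Sum>k=0..m. (-1) ^ k * Pms m k *
        ((1 - Xv) ^ (m + 1 - k) * (1 - Xv * Yv) ^ (m + 1 - k) * (1 - Yv) ^ (3 * k) * Xv ^ k)
        / (\<Prod>i=0..k. 1 - Yv ^ (m + 1 - i)))" .
qed

end
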